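(* Let $R$ be a reduced commutative ring with identity, $\mathcal{M}$ its space of minimal prime ideals, and $R_K(\mathcal{M})$ the ideal of all $a\in R$ for which $\overline{D(a)}$ is compact. Then $R_K(\mathcal{M})$ is an essential ideal if and only if $\mathcal{M}$ is an almost locally compact space.
   Context: $\mathcal{M}$ is the set of minimal prime ideals of $R$ with the Zariski topology, whose base of open sets is $\{D(a): a\in R\}$, where $D(a)=\{P\in\mathcal{M}: a\notin P\}$; $\overline{D(a)}$ is the closure of $D(a)$ in $\mathcal{M}$. A nonzero ideal is essential if it intersects every nonzero ideal nontrivially. A Hausdorff space is almost locally compact if every nonempty open set contains a nonempty open set with compact closure. *)

theory Defs
  imports "HOL-Algebra.Ideal" "HOL-Analysis.T1_Spaces"
begin

(* HOL-Algebra's setoid closure shares its name with the infix of HOL-Analysis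
   for the topological closure; only the latter is used here. *)
no_notation eq_closure_of (\<open>closure'_of\<index>\<close>)

definition reduced_ring :: "('a, 'b) ring_scheme \<Rightarrow> bool" where
  "reduced_ring R \<longleftrightarrow>
     (\<forall>a \<in> carrier R. \<forall>n::nat. a [^]\<^bsub>R\<^esub> n = \<zero>\<^bsub>R\<^esub> \<longrightarrow> a = \<zero>\<^bsub>R\<^esub>)"

definition minimal_primes :: "('a, 'b) ring_scheme \<Rightarrow> 'a set set" where
  "minimal_primes R = {P. primeideal P R \<and> (\<forall>Q. primeideal Q R \<and> Q \<subseteq> P \<longrightarrow> Q = P)}"

definition D_set :: "('a, 'b) ring_scheme \<Rightarrow> 'a \<Rightarrow> 'a set set" where
  "D_set R a = {P \<in> minimal_primes R. a \<notin> P}"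

(* The lemmas openin_minimal_spectrum and topspace_minimal_spectrum below show that
   this is a topology on the minimal primes with base the sets D_set R a. *)
definition minimal_spectrum :: "('a, 'b) ring_scheme \<Rightarrow> 'a set topology" where
  "minimal_spectrum R =
     topology (arbitrary union_of (\<lambda>U. \<exists>a \<in> carrier R. U = D_set R a))"

definition R_K :: "('a, 'b) ring_scheme \<Rightarrow> 'a set" where
  "R_K R = {a \<in> carrier R.
     compactin (minimal_spectrum R) (minimal_spectrum R closure_of D_set R a)}"

definition essential_ideal :: "'a set \<Rightarrow> ('a, 'b) ring_scheme \<Rightarrow> bool" where
  "essential_ideal I R \<longleftrightarrow>
     ideal I R \<and> I \<noteq> {\<zero>\<^bsub>R\<^esub>} \<and>
     (\<forall>J. ideal J R \<and> J \<noteq> {\<zero>\<^bsub>R\<^esub>} \<longrightarrow> I \<inter> J \<noteq> {\<zero>\<^bsub>R\<^esub>})"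

definition almost_locally_compact_space :: "'a topology \<Rightarrow> bool" where
  "almost_locally_compact_space X \<longleftrightarrow>
     Hausdorff_space X \<and>
     (\<forall>U. openin X U \<and> U \<noteq> {} \<longrightarrow>
        (\<exists>V. openin X V \<and> V \<noteq> {} \<and> V \<subseteq> U \<and> compactin X (X closure_of V)))"

lemma (in cring) D_set_mult:
  assumes "a \<in> carrier R" "b \<in> carrier R"
  shows "D_set R (a \<otimes> b) = D_set R a \<inter> D_set R b"
proof -
  have "a \<otimes> b \<in> P \<longleftrightarrow> a \<in> P \<or> b \<in> P" if "primeideal P R" for P
  proof -
    interpret primeideal P R by fact
    show ?thesis
      using I_prime[OF assms] I_l_closed[of b a] I_r_closed[of a b] assms by blast
  qed
  then show ?thesis by (auto simp: D_set_def minimal_primes_def)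
qed

lemma (in cring) openin_minimal_spectrum:
  "openin (minimal_spectrum R) =
     arbitrary union_of (\<lambda>U. \<exists>a \<in> carrier R. U = D_set R a)"
  unfolding minimal_spectrum_def
proof (rule topology_inverse', rule istopology_base)
  fix S T
  assume "\<exists>a \<in> carrier R. S = D_set R a" "\<exists>a \<in> carrier R. T = D_set R a"
  then obtain a b where "a \<in> carrier R" "b \<in> carrier R" "S = D_set R a" "T = D_set R b"
    by blast
  then show "\<exists>a \<in> carrier R. S \<inter> T = D_set R a"
    using D_set_mult[of a b] m_closed[of a b] by (intro bexI[of _ "a \<otimes> b"]) simp_all
qed

lemma (in cring) openin_D_set:
  "a \<in> carrier R \<Longrightarrow> openin (minimal_spectrum R) (D_set R a)"
  unfolding openin_minimal_spectrum by (rule arbitrary_union_of_inc) blast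

lemma (in cring) topspace_minimal_spectrum:
  "topspace (minimal_spectrum R) = minimal_primes R"
proof
  have "arbitrary union_of (\<lambda>U. \<exists>a \<in> carrier R. U = D_set R a)
          \<le> (\<lambda>U. U \<subseteq> minimal_primes R)"
    by (auto simp: union_of_def arbitrary_def D_set_def)
  then show "topspace (minimal_spectrum R) \<subseteq> minimal_primes R"
    unfolding topspace_def openin_minimal_spectrum by blast
  have "\<one> \<notin> P" if "primeideal P R" for P
  proof -
    interpret primeideal P R by fact
    show ?thesis using I_notcarr one_imp_carrier by auto
  qed
  then have "D_set R \<one> = minimal_primes R"
    unfolding D_set_def minimal_primes_def by blast
  then show "minimal_primes R \<subseteq> topspace (minimal_spectrum R)"
    using openin_subset[OF openin_D_set[OF one_closed]] by simp
qed

lemma (in cring) ideal_R_K: "ideal (R_K R) R"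
proof -
  let ?X = "minimal_spectrum R"
  have sub: "c \<in> R_K R"
    if c: "c \<in> carrier R" and ab: "a \<in> R_K R" "b \<in> R_K R"
      and le: "D_set R c \<subseteq> D_set R a \<union> D_set R b" for a b c
  proof -
    have "compactin ?X (?X closure_of (D_set R a \<union> D_set R b))"
      using ab by (simp add: R_K_def closure_of_Un compactin_Un)
    then show ?thesis
      using c closure_of_mono[OF le, of ?X] closed_compactin[of ?X] by (simp add: R_K_def)
  qed
  have is_ideal: "P \<in> minimal_primes R \<Longrightarrow> ideal P R" for P
    by (simp add: minimal_primes_def primeideal.axioms(1))
  have car: "a \<in> R_K R \<Longrightarrow> a \<in> carrier R" for a by (simp add: R_K_def)
  have "D_set R \<zero> = {}"
    using is_ideal by (auto simp: D_set_def ideal_def additive_subgroup.zero_closed)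
  then have zero: "\<zero> \<in> R_K R"
    by (simp add: R_K_def)
  have add: "a \<oplus> b \<in> R_K R" if "a \<in> R_K R" "b \<in> R_K R" for a b
  proof (rule sub[OF _ that])
    show "a \<oplus> b \<in> carrier R" using that car by blast
    have "a \<oplus> b \<in> P" if "P \<in> minimal_primes R" "a \<in> P" "b \<in> P" for P
      using is_ideal[OF that(1)] that(2,3)
      by (meson additive_subgroup.a_closed ideal.axioms(1))
    then show "D_set R (a \<oplus> b) \<subseteq> D_set R a \<union> D_set R b"
      unfolding D_set_def by blast
  qed
  have mult: "x \<otimes> a \<in> R_K R" if "a \<in> R_K R" "x \<in> carrier R" for a x
  proof (rule sub[OF _ that(1) that(1)])
    show "x \<otimes> a \<in> carrier R" using that car by blast
    show "D_set R (x \<otimes> a) \<subseteq> D_set R a \<union> D_set R a"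
      using D_set_mult[OF that(2) car[OF that(1)]] by blast
  qed
  have neg: "\<ominus> a \<in> R_K R" if "a \<in> R_K R" for a
    using mult[of a "\<ominus> \<one>"] that car[of a] by (simp add: l_minus)
  show ?thesis
  proof (rule idealI)
    show "ring R" by (rule ring_axioms)
    show "subgroup (R_K R) (add_monoid R)"
    proof (rule subgroup.intro)
      show "R_K R \<subseteq> carrier (add_monoid R)" using car by auto
      show "x \<otimes>\<^bsub>add_monoid R\<^esub> y \<in> R_K R" if "x \<in> R_K R" "y \<in> R_K R" for x y
        using add[OF that] by simp
      show "\<one>\<^bsub>add_monoid R\<^esub> \<in> R_K R" using zero by simp
      show "inv\<^bsub>add_monoid R\<^esub> x \<in> R_K R" if "x \<in> R_K R" for x
        using neg[OF that] by (simp only: a_inv_def)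
    qed
    show "x \<otimes> a \<in> R_K R" if "a \<in> R_K R" "x \<in> carrier R" for a x
      by (rule mult[OF that])
    show "a \<otimes> x \<in> R_K R" if "a \<in> R_K R" "x \<in> carrier R" for a x
      using mult[OF that] m_comm[OF car[OF that(1)] that(2)] by simp
  qed
qed

end

theory Submission
  imports Defs
begin

text \<open>
  In a reduced ring the nonempty basic open sets \<open>D_set R a\<close> are exactly those with
  \<open>a \<noteq> \<zero>\<close>, because the minimal primes intersect in \<open>\<zero>\<close>
  (\<open>D_set_nonempty_iff\<close>). This makes nonzero ideals and nonempty open sets
  interchangeable. A nonempty open set contains some \<open>D_set R a\<close> with \<open>a \<noteq> \<zero>\<close>, and if
  \<open>R_K R\<close> is essential it contains a nonzero multiple \<open>x\<close> of \<open>a\<close>; then \<open>D_set R x\<close> is a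
  nonempty open subset of \<open>D_set R a\<close> with compact closure. Conversely, a nonzero \<open>a\<close> in an
  ideal \<open>J\<close> gives the nonempty open set \<open>D_set R a\<close>; if a nonempty \<open>D_set R b\<close> inside it has
  compact closure, then \<open>D_set R (a \<otimes> b) = D_set R b\<close>, so that \<open>a \<otimes> b\<close> is a nonzero
  element of both \<open>J\<close> and \<open>R_K R\<close>.

  The space of minimal primes of a reduced ring is Hausdorff: an element \<open>a\<close> of a minimal prime \<open>P\<close> is
  annihilated by some \<open>s \<notin> P\<close> (\<open>minimal_prime_annihilator\<close>), and \<open>a \<otimes> s = \<zero>\<close> makes
  \<open>D_set R a\<close> and \<open>D_set R s\<close> disjoint. Both facts about minimal primes come from one
  application of Zorn's lemma to multiplicative sets that avoid \<open>\<zero>\<close>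
  (\<open>ex_minimal_prime_avoiding\<close>).
\<close>

section \<open>Multiplicative sets and minimal primes\<close>

lemma (in cring) annihilates_of_annihilates_power:
  assumes "reduced_ring R" and s: "s \<in> carrier R" and a: "a \<in> carrier R"
    and "s \<noteq> \<zero>" and eq: "s \<otimes> a [^] (n::nat) = \<zero>"
  shows "s \<otimes> a = \<zero>"
proof -
  obtain k where n: "n = Suc k"
    using assms by (cases n) auto
  have "(s \<otimes> a) [^] n = s [^] k \<otimes> (s \<otimes> a [^] n)"
    using s a by (simp add: n nat_pow_distrib m_ac)
  also have "\<dots> = \<zero>"
    using s eq by simp
  finally show ?thesis
    using assms(1) s a unfolding reduced_ring_def by (meson m_closed)
qed

text \<open>
  This is the smallest multiplicative set containing \<open>S\<close> and \<open>a\<close>; it is what adjoining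
  \<open>a\<close> to \<open>S\<close> produces.
\<close>

lemma (in cring) submonoid_mult_powers:
  assumes S: "submonoid S R" and a: "a \<in> carrier R"
  shows "submonoid {s \<otimes> a [^] (n::nat) | s n. s \<in> S} R"
proof -
  interpret S: submonoid S R by (rule S)
  have car: "s \<in> S \<Longrightarrow> s \<in> carrier R" for s
    using S.subset by blast
  show ?thesis
  proof (rule submonoid.intro)
    show "{s \<otimes> a [^] (n::nat) | s n. s \<in> S} \<subseteq> carrier R"
      using car a by auto
    show "\<one> \<in> {s \<otimes> a [^] (n::nat) | s n. s \<in> S}"
      by (rule CollectI, rule exI[of _ \<one>], rule exI[of _ 0]) simp
  next
    fix x y
    assume "x \<in> {s \<otimes> a [^] (n::nat) | s n. s \<in> S}" "y \<in> {s \<otimes> a [^] (n::nat) | s n. s \<in> S}"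
    then obtain s t and m n :: nat
      where st: "s \<in> S" "t \<in> S" and xy: "x = s \<otimes> a [^] m" "y = t \<otimes> a [^] n"
      by blast
    have "x \<otimes> y = (s \<otimes> t) \<otimes> a [^] (m + n)"
      using a car st by (simp add: xy nat_pow_mult[symmetric] m_ac)
    then show "x \<otimes> y \<in> {s \<otimes> a [^] (n::nat) | s n. s \<in> S}"
      using S.m_closed st by blast
  qed
qed

text \<open>
  Zorn's lemma enlarges the multiplicative set to a maximal one, \<open>S\<close>, that still avoids
  \<open>\<zero>\<close>. An \<open>a \<notin> S\<close> cannot be adjoined, so \<open>s \<otimes> a [^] n = \<zero>\<close> for some
  \<open>s \<in> S\<close>, and \<open>s \<otimes> a = \<zero>\<close> since the ring is reduced. Hence the complement of \<open>S\<close>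
  consists of the elements annihilated by some member of \<open>S\<close>. In this form it is visibly an
  ideal, and it is a minimal prime because a prime below it contains \<open>s \<otimes> a = \<zero>\<close> but not \<open>s\<close>.
\<close>

lemma (in cring) ex_minimal_prime_avoiding:
  assumes red: "reduced_ring R" and S0: "submonoid S0 R" "\<zero> \<notin> S0"
  shows "\<exists>P \<in> minimal_primes R. P \<inter> S0 = {} \<and>
           (\<forall>a \<in> P. \<exists>s \<in> carrier R - P. s \<otimes> a = \<zero>)"
proof -
  define A where "A = {S. submonoid S R \<and> \<zero> \<notin> S \<and> S0 \<subseteq> S}"
  have "\<exists>S \<in> A. \<forall>X \<in> A. S \<subseteq> X \<longrightarrow> X = S"
  proof (rule subset_Zorn_nonempty)
    show "A \<noteq> {}"
      using S0 by (auto simp: A_def)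
  next
    fix C assume "C \<noteq> {}" and "subset.chain A C"
    then have CA: "C \<subseteq> A" and lin: "\<And>X Y. X \<in> C \<Longrightarrow> Y \<in> C \<Longrightarrow> X \<subseteq> Y \<or> Y \<subseteq> X"
      by (auto simp: subset_chain_def)
    have sub: "X \<in> C \<Longrightarrow> submonoid X R" for X
      using CA by (auto simp: A_def)
    have "submonoid (\<Union>C) R"
    proof (rule submonoid.intro)
      show "\<Union>C \<subseteq> carrier R"
        using sub submonoid.subset by blast
      show "\<one> \<in> \<Union>C"
        using sub submonoid.one_closed \<open>C \<noteq> {}\<close> by blast
    next
      fix x y assume "x \<in> \<Union>C" "y \<in> \<Union>C"
      then obtain Z where Z: "Z \<in> C" "x \<in> Z" "y \<in> Z"
        using lin by blast
      then show "x \<otimes> y \<in> \<Union>C"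
        using submonoid.m_closed[OF sub[OF Z(1)] Z(2,3)] by blast
    qed
    then show "\<Union>C \<in> A"
      using CA \<open>C \<noteq> {}\<close> by (auto simp: A_def)
  qed
  then obtain S where "S \<in> A" and max: "\<And>X. X \<in> A \<Longrightarrow> S \<subseteq> X \<Longrightarrow> X = S"
    by blast
  then have S: "submonoid S R" and zero: "\<zero> \<notin> S" and "S0 \<subseteq> S"
    by (auto simp: A_def)
  interpret S: submonoid S R by (rule S)
  have car: "s \<in> S \<Longrightarrow> s \<in> carrier R" for s
    using S.subset by blast
  define P where "P = carrier R - S"
  have ann: "\<exists>s \<in> S. s \<otimes> a = \<zero>" if "a \<in> P" for a
  proof -
    let ?T = "{s \<otimes> a [^] (n::nat) | s n. s \<in> S}"
    have a: "a \<in> carrier R" "a \<notin> S"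
      using that by (auto simp: P_def)
    have "S \<subseteq> ?T"
    proof
      fix s assume "s \<in> S"
      moreover have "s = s \<otimes> a [^] (0::nat)"
        using car[OF \<open>s \<in> S\<close>] by simp
      ultimately show "s \<in> ?T" by blast
    qed
    have "a = \<one> \<otimes> a [^] (1::nat)"
      using a by simp
    then have "a \<in> ?T"
      using S.one_closed by blast
    then have "?T \<noteq> S"
      using a by blast
    then have "?T \<notin> A"
      using max \<open>S \<subseteq> ?T\<close> by blast
    then have "\<zero> \<in> ?T"
      using submonoid_mult_powers[OF S a(1)] \<open>S \<subseteq> ?T\<close> \<open>S0 \<subseteq> S\<close> unfolding A_def by blast
    then obtain s and n :: nat where s: "s \<in> S" "s \<otimes> a [^] n = \<zero>"
      by (smt (verit) mem_Collect_eq)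
    moreover have "s \<noteq> \<zero>"
      using s zero by blast
    ultimately show ?thesis
      using annihilates_of_annihilates_power[OF red car a(1)] by blast
  qed
  have PI: "a \<in> P" if "a \<in> carrier R" "s \<in> S" "s \<otimes> a = \<zero>" for a s
    using that S.m_closed[of s a] zero by (auto simp: P_def)
  have Pcar: "a \<in> P \<Longrightarrow> a \<in> carrier R" for a
    by (simp add: P_def)
  have mult: "x \<otimes> a \<in> P" if a: "a \<in> P" and x: "x \<in> carrier R" for a x
  proof -
    obtain s where s: "s \<in> S" "s \<otimes> a = \<zero>"
      using ann[OF a] by blast
    have "s \<otimes> (x \<otimes> a) = x \<otimes> (s \<otimes> a)"
      using car[OF s(1)] x Pcar[OF a] by (rule m_lcomm)
    also have "\<dots> = \<zero>"
      using s(2) x by simp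
    finally show ?thesis
      using PI[of "x \<otimes> a" s] s x Pcar[OF a] by simp
  qed
  have "ideal P R"
  proof (rule idealI)
    show "ring R" by (rule ring_axioms)
    show "subgroup P (add_monoid R)"
    proof (rule subgroup.intro)
      show "P \<subseteq> carrier (add_monoid R)"
        using Pcar by auto
      show "\<one>\<^bsub>add_monoid R\<^esub> \<in> P"
        using zero by (simp add: P_def)
    next
      fix x y assume xy: "x \<in> P" "y \<in> P"
      obtain s t where st: "s \<in> S" "s \<otimes> x = \<zero>" "t \<in> S" "t \<otimes> y = \<zero>"
        using ann xy by blast
      have "(s \<otimes> t) \<otimes> (x \<oplus> y) = t \<otimes> (s \<otimes> x) \<oplus> s \<otimes> (t \<otimes> y)"
        using car[OF st(1)] car[OF st(3)] Pcar[OF xy(1)] Pcar[OF xy(2)]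
        by (simp add: r_distr m_ac)
      also have "\<dots> = \<zero>"
        using st(2,4) car[OF st(1)] car[OF st(3)] by simp
      finally show "x \<otimes>\<^bsub>add_monoid R\<^esub> y \<in> P"
        using PI[of "x \<oplus> y" "s \<otimes> t"] Pcar[OF xy(1)] Pcar[OF xy(2)] S.m_closed[OF st(1,3)]
        by simp
    next
      fix x assume x: "x \<in> P"
      have "\<ominus> x = (\<ominus> \<one>) \<otimes> x"
        using Pcar[OF x] by (simp add: l_minus)
      then have "\<ominus> x \<in> P"
        using mult[OF x, of "\<ominus> \<one>"] by simp
      then show "inv\<^bsub>add_monoid R\<^esub> x \<in> P"
        by (simp only: a_inv_def)
    qed
    show "x \<otimes> a \<in> P" if "a \<in> P" "x \<in> carrier R" for a x
      by (rule mult[OF that])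
    show "a \<otimes> x \<in> P" if "a \<in> P" "x \<in> carrier R" for a x
      using mult[OF that] m_comm[OF Pcar[OF that(1)] that(2)] by simp
  qed
  then have prime: "primeideal P R"
  proof (rule primeidealI)
    show "cring R" by (rule cring_axioms)
    show "carrier R \<noteq> P"
      using S.one_closed one_closed unfolding P_def by blast
    show "a \<in> P \<or> b \<in> P" if "a \<in> carrier R" "b \<in> carrier R" "a \<otimes> b \<in> P" for a b
      using that S.m_closed[of a b] unfolding P_def by blast
  qed
  have "Q = P" if Q: "primeideal Q R" "Q \<subseteq> P" for Q
  proof
    interpret Q: primeideal Q R by (rule Q)
    show "P \<subseteq> Q"
    proof
      fix a assume a: "a \<in> P"
      obtain s where s: "s \<in> S" "s \<otimes> a = \<zero>"
        using ann[OF a] by blast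
      have "s \<notin> Q"
        using s Q(2) unfolding P_def by blast
      then show "a \<in> Q"
        using Q.I_prime[OF car[OF s(1)] Pcar[OF a]] s(2) Q.zero_closed by simp
    qed
  qed (rule Q)
  then have "P \<in> minimal_primes R"
    using prime by (simp add: minimal_primes_def)
  moreover have "P \<inter> S0 = {}"
    using \<open>S0 \<subseteq> S\<close> by (auto simp: P_def)
  moreover have "\<forall>a \<in> P. \<exists>s \<in> carrier R - P. s \<otimes> a = \<zero>"
    using ann car unfolding P_def by blast
  ultimately show ?thesis by blast
qed

text \<open>
  The complement of \<open>P\<close> is a multiplicative set, so some minimal prime with the annihilation
  property avoids it; that prime is contained in \<open>P\<close> and therefore equals \<open>P\<close>.
\<close>

lemma (in cring) minimal_prime_annihilator:
  assumes "reduced_ring R" and P: "P \<in> minimal_primes R" and "a \<in> P"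
  shows "\<exists>s \<in> carrier R - P. s \<otimes> a = \<zero>"
proof -
  interpret P: primeideal P R
    using P by (simp add: minimal_primes_def)
  have "submonoid (carrier R - P) R"
  proof (rule submonoid.intro)
    show "\<one> \<in> carrier R - P"
      using P.one_imp_carrier P.I_notcarr by auto
    show "x \<otimes> y \<in> carrier R - P" if "x \<in> carrier R - P" "y \<in> carrier R - P" for x y
      using that P.I_prime[of x y] by auto
  qed auto
  then obtain Q where Q: "Q \<in> minimal_primes R" "Q \<inter> (carrier R - P) = {}"
    "\<forall>a \<in> Q. \<exists>s \<in> carrier R - Q. s \<otimes> a = \<zero>"
    using ex_minimal_prime_avoiding[OF assms(1), of "carrier R - P"] P.zero_closed by blast
  have "primeideal Q R"
    using Q(1) by (simp add: minimal_primes_def)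
  moreover from this have "Q \<subseteq> carrier R"
    by (intro additive_subgroup.a_subset ideal.axioms(1) primeideal.axioms(1))
  then have "Q \<subseteq> P"
    using Q(2) by blast
  ultimately have "Q = P"
    using P by (simp add: minimal_primes_def)
  then show ?thesis
    using Q(3) \<open>a \<in> P\<close> by blast
qed

section \<open>Topology of the space of minimal primes\<close>

text \<open>
  A nonzero \<open>a\<close> is not nilpotent, so its powers form a multiplicative set that avoids
  \<open>\<zero>\<close>, and some minimal prime avoids all of them.
\<close>

lemma (in cring) D_set_nonempty_iff:
  assumes red: "reduced_ring R" and a: "a \<in> carrier R"
  shows "D_set R a \<noteq> {} \<longleftrightarrow> a \<noteq> \<zero>"
proof
  have "\<zero> \<in> P" if "P \<in> minimal_primes R" for P
    using that by (simp add: minimal_primes_def primeideal_def ideal_def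
        additive_subgroup.zero_closed)
  then show "D_set R a \<noteq> {} \<Longrightarrow> a \<noteq> \<zero>"
    by (auto simp: D_set_def)
next
  assume "a \<noteq> \<zero>"
  \<comment> \<open>The powers of \<open>a\<close>, obtained by adjoining \<open>a\<close> to the trivial multiplicative set.\<close>
  let ?S = "{s \<otimes> a [^] (n::nat) | s n. s \<in> {\<one>}}"
  have "submonoid {\<one>} R"
    by (rule submonoid.intro) auto
  then have "submonoid ?S R"
    using a by (rule submonoid_mult_powers)
  moreover have "a [^] n \<noteq> \<zero>" for n :: nat
    using a red \<open>a \<noteq> \<zero>\<close> unfolding reduced_ring_def by blast
  then have "\<one> \<otimes> a [^] n \<noteq> \<zero>" for n :: nat
    using a by simp
  then have "\<zero> \<notin> ?S"
    by (intro notI, elim CollectE exE conjE singletonE) metis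
  ultimately obtain P where P: "P \<in> minimal_primes R" "P \<inter> ?S = {}"
    using ex_minimal_prime_avoiding[OF red, of ?S] by blast
  have "a = \<one> \<otimes> a [^] (1::nat)"
    using a by simp
  then have "a \<in> ?S" by blast
  then show "D_set R a \<noteq> {}"
    using P by (auto simp: D_set_def)
qed

lemma (in cring) Hausdorff_minimal_spectrum:
  assumes red: "reduced_ring R"
  shows "Hausdorff_space (minimal_spectrum R)"
  unfolding Hausdorff_space_def topspace_minimal_spectrum
proof (intro allI impI, elim conjE)
  fix P Q assume P: "P \<in> minimal_primes R" and Q: "Q \<in> minimal_primes R" and "P \<noteq> Q"
  then have "\<not> P \<subseteq> Q"
    by (auto simp: minimal_primes_def)
  then obtain a where a: "a \<in> P" "a \<notin> Q" by blast
  have "ideal P R"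
    using P by (simp add: minimal_primes_def primeideal.axioms(1))
  then have acar: "a \<in> carrier R"
    using a(1) by (rule ideal.Icarr)
  obtain s where s: "s \<in> carrier R" "s \<notin> P" "s \<otimes> a = \<zero>"
    using minimal_prime_annihilator[OF red P a(1)] by blast
  have "D_set R s \<inter> D_set R a = {}"
    using D_set_mult[OF s(1) acar] D_set_nonempty_iff[OF red zero_closed] s(3) by simp
  then show "\<exists>U V. openin (minimal_spectrum R) U \<and> openin (minimal_spectrum R) V \<and>
               P \<in> U \<and> Q \<in> V \<and> disjnt U V"
    using s a acar P Q openin_D_set
    by (intro exI[of _ "D_set R s"] exI[of _ "D_set R a"])
       (auto simp: D_set_def disjnt_def)
qed

lemma (in cring) ex_D_set_subset_open:
  assumes red: "reduced_ring R" and "openin (minimal_spectrum R) U" "U \<noteq> {}"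
  shows "\<exists>a \<in> carrier R. a \<noteq> \<zero> \<and> D_set R a \<subseteq> U"
proof -
  obtain P where "P \<in> U"
    using assms(3) by blast
  obtain \<B> where \<B>: "\<B> \<subseteq> {B. \<exists>a \<in> carrier R. B = D_set R a}" "\<Union>\<B> = U"
    using assms(2) unfolding openin_minimal_spectrum union_of_def arbitrary_def by auto
  then obtain a where a: "a \<in> carrier R" "P \<in> D_set R a" "D_set R a \<subseteq> U"
    using \<open>P \<in> U\<close> by blast
  then show ?thesis
    using D_set_nonempty_iff[OF red a(1)] by blast
qed

section \<open>Essentiality and compact closures\<close>

lemma (in cring) essential_R_K_iff:
  assumes red: "reduced_ring R" and one_not_zero: "\<one> \<noteq> \<zero>"
  shows "essential_ideal (R_K R) R \<longleftrightarrow> almost_locally_compact_space (minimal_spectrum R)"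
proof -
  let ?X = "minimal_spectrum R"
  have zero_mem: "ideal I R \<Longrightarrow> \<zero> \<in> I" for I
    by (simp add: ideal_def additive_subgroup.zero_closed)
  show ?thesis
  proof
    assume ess: "essential_ideal (R_K R) R"
    have "\<exists>V. openin ?X V \<and> V \<noteq> {} \<and> V \<subseteq> U \<and> compactin ?X (?X closure_of V)"
      if U: "openin ?X U" "U \<noteq> {}" for U
    proof -
      obtain a where a: "a \<in> carrier R" "a \<noteq> \<zero>" "D_set R a \<subseteq> U"
        using ex_D_set_subset_open[OF red U] by blast
      have J: "ideal (PIdl a) R" "PIdl a \<noteq> {\<zero>}"
        using cgenideal_ideal[OF a(1)] cgenideal_self[OF a(1)] a(2) by auto
      then have "R_K R \<inter> PIdl a \<noteq> {\<zero>}"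
        using ess by (simp add: essential_ideal_def)
      then obtain x where x: "x \<in> R_K R" "x \<in> PIdl a" "x \<noteq> \<zero>"
        using zero_mem[OF J(1)] zero_mem[OF ideal_R_K] by blast
      obtain r where r: "r \<in> carrier R" "x = r \<otimes> a"
        using x(2) by (auto simp: cgenideal_def)
      have xcar: "x \<in> carrier R"
        using r a(1) by simp
      have "D_set R x \<subseteq> U"
        using D_set_mult[OF r(1) a(1)] r(2) a(3) by auto
      then show ?thesis
        using x openin_D_set[OF xcar] D_set_nonempty_iff[OF red xcar]
        by (intro exI[of _ "D_set R x"]) (simp add: R_K_def)
    qed
    then show "almost_locally_compact_space ?X"
      using Hausdorff_minimal_spectrum[OF red] by (simp add: almost_locally_compact_space_def)
  next
    assume alc: "almost_locally_compact_space ?X"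
    have inter: "R_K R \<inter> J \<noteq> {\<zero>}" if J: "ideal J R" "J \<noteq> {\<zero>}" for J
    proof -
      obtain a where a: "a \<in> J" "a \<noteq> \<zero>"
        using J zero_mem by blast
      have acar: "a \<in> carrier R"
        using ideal.Icarr[OF J(1) a(1)] .
      have "D_set R a \<noteq> {}"
        using D_set_nonempty_iff[OF red acar] a(2) by blast
      then obtain V where V: "openin ?X V" "V \<noteq> {}" "V \<subseteq> D_set R a"
        "compactin ?X (?X closure_of V)"
        using alc openin_D_set[OF acar] unfolding almost_locally_compact_space_def by meson
      obtain b where b: "b \<in> carrier R" "b \<noteq> \<zero>" "D_set R b \<subseteq> V"
        using ex_D_set_subset_open[OF red V(1,2)] by blast
      have car: "a \<otimes> b \<in> carrier R"
        using acar b(1) by simp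
      have D: "D_set R (a \<otimes> b) = D_set R b"
        using D_set_mult[OF acar b(1)] b(3) V(3) by blast
      have "a \<otimes> b \<noteq> \<zero>"
        using D_set_nonempty_iff[OF red car] D_set_nonempty_iff[OF red b(1)] D b(2) by simp
      moreover have "a \<otimes> b \<in> J"
        using ideal.I_r_closed[OF J(1) a(1) b(1)] .
      moreover have "compactin ?X (?X closure_of D_set R b)"
        using closed_compactin[OF V(4) closure_of_mono[OF b(3)]] by simp
      then have "a \<otimes> b \<in> R_K R"
        using car D by (simp add: R_K_def)
      ultimately show ?thesis by blast
    qed
    \<comment> \<open>Meeting the unit ideal nontrivially is what makes \<open>R_K R\<close> itself nonzero.\<close>
    have "carrier R \<noteq> {\<zero>}"
      using one_not_zero one_closed by blast
    then have "R_K R \<noteq> {\<zero>}"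
      using inter[OF oneideal] zero_closed by blast
    then show "essential_ideal (R_K R) R"
      using ideal_R_K inter by (simp add: essential_ideal_def)
  qed
qed

theorem theorem2p13:
  fixes R :: "('a, 'b) ring_scheme"
  assumes "cring R"
    and "\<one>\<^bsub>R\<^esub> \<noteq> \<zero>\<^bsub>R\<^esub>"
    and "reduced_ring R"
  shows "essential_ideal (R_K R) R \<longleftrightarrow> almost_locally_compact_space (minimal_spectrum R)"
  by (rule cring.essential_R_K_iff[OF assms(1,3,2)])

end
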